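(* Let $X$ be a quasi-king space which has a properly continuous weak selection. Then $X$ is weakly orderable.
   Context: All spaces are Hausdorff topological spaces. For a set $X$, let $\mathscr{F}_2(X)=\{S\subset X: 1\le |S|\le 2\}$. A weak selection for $X$ is a map $\sigma:\mathscr{F}_2(X)\to X$ with $\sigma(S)\in S$ for every $S\in\mathscr{F}_2(X)$. It generates the (total, antisymmetric, not necessarily transitive) relation $x\leq_\sigma y$ iff $\sigma(\{x,y\})=x$; write $x<_\sigma y$ if $x\leq_\sigma y$ and $x\neq y$. The selection topology $\mathscr{T}_\sigma$ on $X$ is the topology with subbase consisting of all sets $\{y\in X: y<_\sigma x\}$ and $\{y\in X: x<_\sigma y\}$, $x\in X$. A weak selection $\sigma$ for a topological space is continuous if for every $x,y\in X$ with $x<_\sigma y$ there are open sets $U\ni x$, $V\ni y$ with $s<_\sigma t$ for all $s\in U$, $t\in V$. A weak selection $\sigma$ for a space $(X,\mathscr{T})$ is separately continuous if $\mathscr{T}_\sigma\subset\mathscr{T}$; it is properly continuous if $\mathscr{T}_\sigma\subset\mathscr{T}$ and $\sigma$ is continuous with respect to the topology $\mathscr{T}_\sigma$. A point $q\in X$ is a quasi $\sigma$-king if for each $x\in X$ there are finitely many points $y_1,\dots,y_n\in X$ with $x\leq_\sigma y_1\leq_\sigma\dots\leq_\sigma y_n\leq_\sigma q$. A space $X$ is quasi-king if it has a separately continuous weak selection, and every separately continuous weak selection $\sigma$ for $X$ has a quasi $\sigma$-king. A space $(X,\mathscr{T})$ is weakly orderable if there is a linear order $\leq$ on $X$ whose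 open interval topology $\mathscr{T}_\leq$ satisfies $\mathscr{T}_\leq\subset\mathscr{T}$. *)

theory Defs
  imports "HOL-Analysis.Analysis"
begin

definition F2 :: "'a set \<Rightarrow> 'a set set" where
  "F2 X = {S. S \<subseteq> X \<and> 1 \<le> card S \<and> card S \<le> 2}"

text \<open>A weak selection is a total function on sets whose values outside \<open>F2 X\<close> are
  unconstrained; none of the notions below depends on them.\<close>

definition weak_selection_on :: "'a set \<Rightarrow> ('a set \<Rightarrow> 'a) \<Rightarrow> bool" where
  "weak_selection_on X \<sigma> \<longleftrightarrow> (\<forall>S\<in>F2 X. \<sigma> S \<in> S)"

definition sel_le :: "('a set \<Rightarrow> 'a) \<Rightarrow> 'a \<Rightarrow> 'a \<Rightarrow> bool" where
  "sel_le \<sigma> x y \<longleftrightarrow> \<sigma> {x, y} = x"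

definition sel_less :: "('a set \<Rightarrow> 'a) \<Rightarrow> 'a \<Rightarrow> 'a \<Rightarrow> bool" where
  "sel_less \<sigma> x y \<longleftrightarrow> sel_le \<sigma> x y \<and> x \<noteq> y"

text \<open>The set \<open>X\<close> itself is added to the generators since \<open>topology_generated_by\<close> does not
  include the empty intersection of subbasic sets, which matters when \<open>X\<close> is a singleton.\<close>

definition selection_topology :: "'a set \<Rightarrow> ('a set \<Rightarrow> 'a) \<Rightarrow> 'a topology" where
  "selection_topology X \<sigma> = topology_generated_by
     ({X} \<union> {{y \<in> X. sel_less \<sigma> y x} |x. x \<in> X} \<union> {{y \<in> X. sel_less \<sigma> x y} |x. x \<in> X})"

definition coarser_topology :: "'a topology \<Rightarrow> 'a topology \<Rightarrow> bool" where
  "coarser_topology S T \<longleftrightarrow> (\<forall>U. openin S U \<longrightarrow> openin T U)"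

definition continuous_weak_selection :: "'a topology \<Rightarrow> ('a set \<Rightarrow> 'a) \<Rightarrow> bool" where
  "continuous_weak_selection T \<sigma> \<longleftrightarrow>
     weak_selection_on (topspace T) \<sigma> \<and>
     (\<forall>x\<in>topspace T. \<forall>y\<in>topspace T. sel_less \<sigma> x y \<longrightarrow>
        (\<exists>U V. openin T U \<and> openin T V \<and> x \<in> U \<and> y \<in> V \<and>
               (\<forall>s\<in>U. \<forall>t\<in>V. sel_less \<sigma> s t)))"

definition separately_continuous_weak_selection :: "'a topology \<Rightarrow> ('a set \<Rightarrow> 'a) \<Rightarrow> bool" where
  "separately_continuous_weak_selection T \<sigma> \<longleftrightarrow>
     weak_selection_on (topspace T) \<sigma> \<and>
     coarser_topology (selection_topology (topspace T) \<sigma>) T"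

definition properly_continuous_weak_selection :: "'a topology \<Rightarrow> ('a set \<Rightarrow> 'a) \<Rightarrow> bool" where
  "properly_continuous_weak_selection T \<sigma> \<longleftrightarrow>
     weak_selection_on (topspace T) \<sigma> \<and>
     coarser_topology (selection_topology (topspace T) \<sigma>) T \<and>
     continuous_weak_selection (selection_topology (topspace T) \<sigma>) \<sigma>"

definition quasi_sel_king :: "'a set \<Rightarrow> ('a set \<Rightarrow> 'a) \<Rightarrow> 'a \<Rightarrow> bool" where
  "quasi_sel_king X \<sigma> q \<longleftrightarrow>
     q \<in> X \<and>
     (\<forall>x\<in>X. \<exists>ys. ys \<noteq> [] \<and> set ys \<subseteq> X \<and> successively (sel_le \<sigma>) (x # ys @ [q]))"

definition quasi_king_space :: "'a topology \<Rightarrow> bool" where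
  "quasi_king_space T \<longleftrightarrow>
     (\<exists>\<sigma>. separately_continuous_weak_selection T \<sigma>) \<and>
     (\<forall>\<sigma>. separately_continuous_weak_selection T \<sigma> \<longrightarrow> (\<exists>q. quasi_sel_king (topspace T) \<sigma> q))"

text \<open>As in the class \<open>order_topology\<close>, the open rays form a subbase: every bounded open interval
  is an intersection of two of them. The set \<open>X\<close> is added as for \<open>selection_topology\<close>.\<close>

definition open_interval_topology :: "'a set \<Rightarrow> 'a rel \<Rightarrow> 'a topology" where
  "open_interval_topology X r = topology_generated_by
     ({X} \<union> {{y \<in> X. (y, x) \<in> r \<and> y \<noteq> x} |x. x \<in> X} \<union> {{y \<in> X. (x, y) \<in> r \<and> x \<noteq> y} |x. x \<in> X})"

definition weakly_orderable_space :: "'a topology \<Rightarrow> bool" where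
  "weakly_orderable_space T \<longleftrightarrow>
     (\<exists>r. linear_order_on (topspace T) r \<and>
          coarser_topology (open_interval_topology (topspace T) r) T)"

end

theory Submission
  imports Defs
begin

text \<open>
  A weak selection \<open>\<sigma>\<close> makes \<open>X\<close> a tournament \<open>\<sqsubset>\<close>, which may contain cycles. A linear order is made
  from it by sorting: well-order \<open>X\<close>, and let the points act as pivots one after the other, each
  pivot \<open>p\<close> splitting the cell it lies in at that time into the points below \<open>p\<close>, the point \<open>p\<close>
  and the points above \<open>p\<close>. Two distinct points are compared by the pivot that first
  separates them (\<open>before\<close>). This is a linear order for every tournament; only the openness of its
  rays depends on the topology. Let \<open>\<tau>\<close> be the selection topology, in which \<open>\<sigma>\<close> is continuous.
  If a ray \<open>{x. before x y}\<close> fails to be open at \<open>x\<close>, then there are a point \<open>w\<close> with \<open>x \<sqsubset> w\<close> and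
  points \<open>z\<close> arbitrarily near to \<open>x\<close> that lie on cycles \<open>z \<sqsubset> w \<sqsubset> q \<sqsubset> z\<close> with \<open>x \<sqsubset> q\<close>, where
  \<open>q\<close> is a pivot (\<open>openin_before\<close>). So it is enough to show that such cycles do not accumulate.

  Any two points of a 3-cycle are separated by a \<open>\<tau>\<close>-clopen set, because \<open>{y. y \<sqsubset> b \<and> c \<sqsubset> y}\<close> is
  clopen when \<open>b \<sqsubset> c\<close> (\<open>cycle_separated\<close>), and the relation between two separated points persists
  on clopen neighbourhoods of them (\<open>separated_clopen_clopen\<close>). Accumulating cycles
  therefore yield nonempty clopen sets \<open>Z n\<close> and \<open>Q n\<close> around points \<open>z\<close> and \<open>q\<close> such that
  \<open>Q n\<close> lies below \<open>Z n\<close> but above all later \<open>Z k\<close>, while \<open>Z n\<close> and \<open>Q n\<close> stay in two disjoint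
  closed sets. If sequences of nonempty clopen sets have cluster points, then the first property
  makes a cluster point of the \<open>Z n\<close> coincide with one of the \<open>Q n\<close>, against the second
  (\<open>no_nested_cycle_sequence\<close>).

  The cluster points come from quasi-kings. Given a locally constant \<open>f :: 'a \<Rightarrow> nat\<close>, the
  lexicographic combination of \<open>f\<close> with \<open>\<sigma>\<close> is again separately continuous, and a quasi-king for it
  maximises \<open>f\<close>; so \<open>f\<close> is bounded (\<open>quasi_king_bounds_locally_constant\<close>). A sequence of nonempty
  clopen sets without cluster points would give an unbounded \<open>f\<close>, namely the last index
  of a set that contains the given point (\<open>cluster_point_of_clopen_sets\<close>).
\<close>
section \<open>Tournaments and sorting by pivots\<close>

locale tournament =
  fixes X :: "'a set" and lt :: "'a \<Rightarrow> 'a \<Rightarrow> bool" (infix "\<sqsubset>" 50)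
  assumes lt_in: "x \<sqsubset> y \<Longrightarrow> x \<in> X \<and> y \<in> X"
    and lt_asym: "x \<sqsubset> y \<Longrightarrow> \<not> y \<sqsubset> x"
    and lt_total: "x \<in> X \<Longrightarrow> y \<in> X \<Longrightarrow> x \<noteq> y \<Longrightarrow> x \<sqsubset> y \<or> y \<sqsubset> x"
begin

lemma lt_irrefl [simp]: "\<not> x \<sqsubset> x"
  using lt_asym by blast

lemma tournament_reverse: "tournament X (\<lambda>x y. y \<sqsubset> x)"
  by unfold_locales (use lt_in lt_asym lt_total in blast)+

definition same_side :: "'a \<Rightarrow> 'a \<Rightarrow> 'a \<Rightarrow> bool" where
  "same_side r x y \<longleftrightarrow> (x \<sqsubset> r \<longleftrightarrow> y \<sqsubset> r) \<and> (r \<sqsubset> x \<longleftrightarrow> r \<sqsubset> y)"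

end

text \<open>
  The relation \<open>W\<close> is a strict well-order, the order in which the points serve as pivots. It is
  unrelated to the tournament.
\<close>
locale pivot_order = tournament +
  fixes W :: "('a \<times> 'a) set"
  assumes wfW: "wf W" and transW: "trans W"
    and totalW: "x \<noteq> y \<Longrightarrow> (x, y) \<in> W \<or> (y, x) \<in> W"
begin

text \<open>
  The cell of \<open>p\<close> consists of the points that no earlier pivot has separated from \<open>p\<close>. Only those
  pivots \<open>r\<close> count whose own cell contains \<open>p\<close>, that is, the ancestors of \<open>p\<close> in the search
  tree. Letting all earlier points split would still give a linear order, but the
  proof of \<open>openin_before\<close> needs that a pivot lies in the cell which it splits.
\<close>
definition cell :: "'a \<Rightarrow> 'a set" where
  "cell = wfrec W (\<lambda>cell p. {x \<in> X. \<forall>r\<in>X. (r, p) \<in> W \<longrightarrow> p \<in> cell r \<longrightarrow> same_side r x p})"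

definition before :: "'a \<Rightarrow> 'a \<Rightarrow> bool" where
  "before x y \<longleftrightarrow> x \<noteq> y \<and>
     (\<exists>p\<in>X. x \<in> cell p \<and> y \<in> cell p \<and> (x = p \<or> x \<sqsubset> p) \<and> (y = p \<or> p \<sqsubset> y))"

lemma cell_iff:
  "x \<in> cell p \<longleftrightarrow> x \<in> X \<and> (\<forall>r\<in>X. (r, p) \<in> W \<longrightarrow> p \<in> cell r \<longrightarrow> same_side r x p)"
proof -
  have "cell p = {x \<in> X. \<forall>r\<in>X. (r, p) \<in> W \<longrightarrow> p \<in> cut cell W p r \<longrightarrow> same_side r x p}"
    using wfrec[OF wfW, of "\<lambda>cell p. {x \<in> X. \<forall>r\<in>X. (r, p) \<in> W \<longrightarrow> p \<in> cell r \<longrightarrow> same_side r x p}" p]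
    unfolding cell_def .
  also have "\<dots> = {x \<in> X. \<forall>r\<in>X. (r, p) \<in> W \<longrightarrow> p \<in> cell r \<longrightarrow> same_side r x p}"
    by (intro Collect_cong conj_cong ball_cong refl imp_cong) (simp only: cut_apply)
  finally have "x \<in> cell p \<longleftrightarrow> x \<in> {x \<in> X. \<forall>r\<in>X. (r, p) \<in> W \<longrightarrow> p \<in> cell r \<longrightarrow> same_side r x p}"
    by (rule arg_cong)
  then show ?thesis unfolding mem_Collect_eq .
qed

lemma cell_in: "x \<in> cell p \<Longrightarrow> x \<in> X"
  by (subst (asm) cell_iff) (rule conjunct1)

lemma cell_same_side:
  "x \<in> cell p \<Longrightarrow> r \<in> X \<Longrightarrow> (r, p) \<in> W \<Longrightarrow> p \<in> cell r \<Longrightarrow> same_side r x p"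
  by (subst (asm) cell_iff) blast

lemma cellI:
  "x \<in> X \<Longrightarrow> (\<And>r. r \<in> X \<Longrightarrow> (r, p) \<in> W \<Longrightarrow> p \<in> cell r \<Longrightarrow> same_side r x p) \<Longrightarrow> x \<in> cell p"
  by (subst cell_iff) blast

lemma pivot_in_cell: "p \<in> X \<Longrightarrow> p \<in> cell p"
  by (rule cellI) (simp_all add: same_side_def)

lemma cell_nested:
  assumes "(r', r) \<in> W" "r' \<in> X" "r \<in> cell r'" "x \<in> cell r"
  shows "x \<in> cell r'"
  using assms
proof (induction r' arbitrary: r x rule: wf_induct_rule[OF wfW])
  case (1 r')
  have "same_side s x r'" if s: "s \<in> X" "(s, r') \<in> W" "r' \<in> cell s" for s
  proof -
    have sr: "(s, r) \<in> W" using s(2) 1(2) transD[OF transW] by blast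
    have "r \<in> cell s" using 1(1)[OF s(2) s(2) s(1) s(3) 1(4)] .
    then have "same_side s x r" using cell_same_side[OF 1(5) s(1) sr] by blast
    moreover have "same_side s r r'" using cell_same_side[OF 1(4) s] .
    ultimately show ?thesis by (simp add: same_side_def)
  qed
  then show ?case using cellI[OF cell_in[OF 1(5)]] by blast
qed

text \<open>
  Two cells that meet are nested, as in a search tree: the one with the later pivot is the smaller
  one.
\<close>
lemma later_pivot_in_cell:
  assumes "(p, p') \<in> W" "p \<in> X" "p' \<in> X" "x \<in> cell p" "x \<in> cell p'"
  shows "p' \<in> cell p"
  using assms
proof (induction p rule: wf_induct_rule[OF wfW])
  case (1 p)
  have "same_side s p' p" if s: "s \<in> X" "(s, p) \<in> W" "p \<in> cell s" for s
  proof -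
    have sp': "(s, p') \<in> W" using s(2) 1(2) transD[OF transW] by blast
    have "x \<in> cell s" using cell_nested[OF s(2,1,3) 1(5)] .
    then have "p' \<in> cell s" using 1(1)[OF s(2) sp' s(1) 1(4) _ 1(6)] by blast
    then have "same_side s x p'" using cell_same_side[OF 1(6) s(1) sp'] by blast
    moreover have "same_side s x p" using cell_same_side[OF 1(5) s] .
    ultimately show ?thesis by (simp add: same_side_def)
  qed
  then show ?case using cellI[OF 1(4)] by blast
qed

text \<open>
  An earlier pivot does not split a later cell that meets its own. Hence at most one pivot separates
  two given points while both are in its cell.
\<close>
lemma later_cell_same_side:
  assumes "(p, p') \<in> W" "p \<in> X" "p' \<in> X" "x \<in> cell p" "x \<in> cell p'" "y \<in> cell p'"
  shows "p' \<in> cell p \<and> y \<in> cell p \<and> same_side p p' x \<and> same_side p y x"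
proof -
  have p': "p' \<in> cell p" using later_pivot_in_cell[OF assms(1-5)] .
  have "y \<in> cell p" using cell_nested[OF assms(1,2) p' assms(6)] .
  moreover have "same_side p x p'" "same_side p y p'"
    using cell_same_side[OF _ assms(2,1) p'] assms(5,6) by blast+
  ultimately show ?thesis using p' by (simp add: same_side_def)
qed

lemma straddle:
  assumes "x \<in> X" "y \<in> X" "p \<in> X" "\<not> same_side p x y"
  shows "(x = p \<or> x \<sqsubset> p) \<and> (y = p \<or> p \<sqsubset> y) \<or> (y = p \<or> y \<sqsubset> p) \<and> (x = p \<or> p \<sqsubset> x)"
proof -
  have "x = p \<or> x \<sqsubset> p \<or> p \<sqsubset> x" "y = p \<or> y \<sqsubset> p \<or> p \<sqsubset> y"
    using lt_total assms by blast+
  then show ?thesis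
    using assms(4) by (elim disjE) (auto simp: same_side_def dest: lt_asym)
qed

lemma straddle_not_same_side:
  assumes "x \<noteq> y" "x = p \<or> x \<sqsubset> p" "y = p \<or> p \<sqsubset> y"
  shows "\<not> same_side p x y" "\<not> same_side p y x"
  using assms by (auto simp: same_side_def dest: lt_asym)

lemma before_in: "before x y \<Longrightarrow> x \<in> X \<and> y \<in> X"
  unfolding before_def using cell_in by blast

lemma beforeI:
  "x \<noteq> y \<Longrightarrow> p \<in> X \<Longrightarrow> x \<in> cell p \<Longrightarrow> y \<in> cell p \<Longrightarrow> x = p \<or> x \<sqsubset> p \<Longrightarrow> y = p \<or> p \<sqsubset> y
    \<Longrightarrow> before x y"
  unfolding before_def by blast

lemma beforeE:
  assumes "before x y"
  obtains p where "x \<noteq> y" "p \<in> X" "x \<in> cell p" "y \<in> cell p" "x = p \<or> x \<sqsubset> p" "y = p \<or> p \<sqsubset> y"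
  using assms unfolding before_def by blast

text \<open>
  If \<open>y\<close> is in the cell of \<open>x\<close>, then \<open>x\<close> itself separates the two points; otherwise some ancestor of
  \<open>x\<close> does, and the earliest such ancestor still has \<open>y\<close> in its cell.
\<close>
lemma before_total:
  assumes "x \<in> X" "y \<in> X" "x \<noteq> y"
  shows "before x y \<or> before y x"
proof -
  have "\<exists>p\<in>X. x \<in> cell p \<and> y \<in> cell p \<and> \<not> same_side p x y"
  proof (cases "y \<in> cell x")
    case True
    have "\<not> same_side x x y" using lt_total[OF assms] by (auto simp: same_side_def)
    then have "x \<in> cell x \<and> y \<in> cell x \<and> \<not> same_side x x y"
      using True pivot_in_cell[OF assms(1)] by simp
    then show ?thesis using assms(1) by blast
  next
    case False
    define S where "S = {r \<in> X. (r, x) \<in> W \<and> x \<in> cell r \<and> \<not> same_side r y x}"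
    have "S \<noteq> {}" using cellI[OF assms(2), of x] False unfolding S_def by blast
    then obtain r0 where "r0 \<in> S" by blast
    then have "\<exists>r\<in>S. \<forall>s. (s, r) \<in> W \<longrightarrow> s \<notin> S"
      by (rule wfE_min[OF wfW]) blast
    then obtain r where r: "r \<in> S" and min: "\<And>s. (s, r) \<in> W \<Longrightarrow> s \<notin> S"
      by blast
    have "same_side s y r" if s: "s \<in> X" "(s, r) \<in> W" "r \<in> cell s" for s
    proof -
      have sx: "(s, x) \<in> W" using s(2) r transD[OF transW] unfolding S_def by blast
      have "x \<in> cell r" using r unfolding S_def by blast
      then have "x \<in> cell s" "same_side s x r"
        using cell_nested[OF s(2,1,3)] cell_same_side[OF _ s] by blast+
      moreover have "same_side s y x" using min[OF s(2)] s(1) sx calculation(1) unfolding S_def by blast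
      ultimately show ?thesis by (simp add: same_side_def)
    qed
    then have "y \<in> cell r" using cellI[OF assms(2)] by blast
    then show ?thesis using r unfolding S_def same_side_def by blast
  qed
  then obtain p where p: "p \<in> X" "x \<in> cell p" "y \<in> cell p" "\<not> same_side p x y" by blast
  have "(x = p \<or> x \<sqsubset> p) \<and> (y = p \<or> p \<sqsubset> y) \<or> (y = p \<or> y \<sqsubset> p) \<and> (x = p \<or> p \<sqsubset> x)"
    using straddle[OF assms(1,2) p(1,4)] .
  then show ?thesis
  proof
    assume "(x = p \<or> x \<sqsubset> p) \<and> (y = p \<or> p \<sqsubset> y)"
    then show ?thesis using beforeI[of x y p] p assms(3) by simp
  next
    assume "(y = p \<or> y \<sqsubset> p) \<and> (x = p \<or> p \<sqsubset> x)"
    then show ?thesis using beforeI[of y x p] p assms(3) by simp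
  qed
qed

lemma before_asym:
  assumes "before x y"
  shows "\<not> before y x"
proof
  assume "before y x"
  then obtain p' where p': "p' \<in> X" "x \<in> cell p'" "y \<in> cell p'" "y = p' \<or> y \<sqsubset> p'" "x = p' \<or> p' \<sqsubset> x"
    by (rule beforeE)
  from assms obtain p where "x \<noteq> y"
    and p: "p \<in> X" "x \<in> cell p" "y \<in> cell p" "x = p \<or> x \<sqsubset> p" "y = p \<or> p \<sqsubset> y"
    by (rule beforeE)
  have ns: "\<not> same_side p y x" "\<not> same_side p' y x"
    using straddle_not_same_side[OF \<open>x \<noteq> y\<close> p(4,5)]
      straddle_not_same_side[OF \<open>x \<noteq> y\<close>[symmetric] p'(4,5)] by blast+
  consider "p = p'" | "(p, p') \<in> W" | "(p', p) \<in> W" using totalW by blast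
  then show False
  proof cases
    case 1
    then show ?thesis using p(4,5) p'(4,5) \<open>x \<noteq> y\<close> by (auto dest: lt_asym)
  next
    case 2
    then show ?thesis using later_cell_same_side[OF 2 p(1) p'(1) p(2) p'(2) p'(3)] ns by blast
  next
    case 3
    then show ?thesis using later_cell_same_side[OF 3 p'(1) p(1) p'(2) p(2) p(3)] ns by blast
  qed
qed

lemma before_trans:
  assumes "before x y" "before y z"
  shows "before x z"
proof -
  from assms(1) obtain p where "x \<noteq> y"
    and p: "p \<in> X" "x \<in> cell p" "y \<in> cell p" "x = p \<or> x \<sqsubset> p" "y = p \<or> p \<sqsubset> y"
    by (rule beforeE)
  from assms(2) obtain p' where "y \<noteq> z"
    and p': "p' \<in> X" "y \<in> cell p'" "z \<in> cell p'" "y = p' \<or> y \<sqsubset> p'" "z = p' \<or> p' \<sqsubset> z"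
    by (rule beforeE)
  have xz: "x \<noteq> z" using assms before_asym[of x y] by blast
  consider "p = p'" | "(p, p') \<in> W" | "(p', p) \<in> W" using totalW by blast
  then show ?thesis
  proof cases
    case 1
    then show ?thesis using beforeI[OF xz p(1,2) _ p(4)] p'(3,5) by simp
  next
    case 2
    have "z \<in> cell p" "same_side p z y"
      using later_cell_same_side[OF 2 p(1) p'(1) p(3) p'(2) p'(3)] by blast+
    moreover have "z = p \<or> p \<sqsubset> z"
      using calculation(2) p(1,5) lt_total[OF p(1) cell_in[OF calculation(1)]]
      by (auto simp: same_side_def)
    ultimately show ?thesis using beforeI[OF xz p(1,2) _ p(4)] by blast
  next
    case 3
    have "x \<in> cell p'" "same_side p' x y"
      using later_cell_same_side[OF 3 p'(1) p(1) p'(2) p(3) p(2)] by blast+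
    moreover have "x = p' \<or> x \<sqsubset> p'"
      using calculation(2) p'(1,4) lt_total[OF p'(1) cell_in[OF calculation(1)]]
      by (auto simp: same_side_def)
    ultimately show ?thesis using beforeI[OF xz p'(1) _ p'(3) _ p'(5)] by blast
  qed
qed

lemma pivot_order_reverse: "pivot_order X (\<lambda>x y. y \<sqsubset> x) W"
  using tournament_reverse wfW transW totalW
  by (simp add: pivot_order_def pivot_order_axioms_def)

interpretation rev: pivot_order X "\<lambda>x y. y \<sqsubset> x" W
  by (rule pivot_order_reverse)

lemma rev_same_side: "rev.same_side = same_side"
  by (auto simp: rev.same_side_def same_side_def fun_eq_iff)

lemma rev_cell: "rev.cell = cell"
  by (simp add: rev.cell_def cell_def rev_same_side)

text \<open>
  Cells are defined symmetrically in the two directions of the tournament, so every statement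
  about rays of the sorted order has to be proved for one direction only.
\<close>
lemma before_reverse: "pivot_order.before X (\<lambda>x y. y \<sqsubset> x) W x y \<longleftrightarrow> before y x"
  unfolding rev.before_def before_def rev_cell by blast

end

section \<open>Clopen sets in the topology of a tournament\<close>

definition clopenin :: "'a topology \<Rightarrow> 'a set \<Rightarrow> bool" where
  "clopenin T K \<longleftrightarrow> openin T K \<and> closedin T K"

text \<open>
  Two points that are not separated belong to the same quasi-component.
\<close>

definition clopen_separated :: "'a topology \<Rightarrow> 'a \<Rightarrow> 'a \<Rightarrow> bool" where
  "clopen_separated T x y \<longleftrightarrow> (\<exists>K. clopenin T K \<and> x \<in> K \<and> y \<notin> K)"

lemma clopenin_Int: "clopenin T K \<Longrightarrow> clopenin T L \<Longrightarrow> clopenin T (K \<inter> L)"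
  by (simp add: clopenin_def openin_Int closedin_Int)

lemma clopenin_Compl: "clopenin T K \<Longrightarrow> clopenin T (topspace T - K)"
  by (simp add: clopenin_def openin_diff closedin_diff)

lemma clopenin_topspace: "clopenin T (topspace T)"
  by (simp add: clopenin_def)

lemma clopenin_subset: "clopenin T K \<Longrightarrow> K \<subseteq> topspace T"
  by (simp add: clopenin_def openin_subset)

lemma clopen_separated_sym:
  "clopen_separated T x y \<Longrightarrow> y \<in> topspace T \<Longrightarrow> clopen_separated T y x"
  unfolding clopen_separated_def using clopenin_Compl by fastforce

locale tournament_space = tournament +
  fixes tau :: "'a topology"
  assumes tau_eq: "tau = topology_generated_by
      ({X} \<union> {{y. y \<sqsubset> x} |x. x \<in> X} \<union> {{y. x \<sqsubset> y} |x. x \<in> X})"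
    and lt_continuous: "x \<sqsubset> y \<Longrightarrow>
      \<exists>U V. openin tau U \<and> openin tau V \<and> x \<in> U \<and> y \<in> V \<and> (\<forall>s\<in>U. \<forall>t\<in>V. s \<sqsubset> t)"
begin

abbreviation "sep \<equiv> clopen_separated tau"

lemma tournament_space_reverse: "tournament_space X (\<lambda>x y. y \<sqsubset> x) tau"
proof -
  have "tau = topology_generated_by
      ({X} \<union> {{y. x \<sqsubset> y} |x. x \<in> X} \<union> {{y. y \<sqsubset> x} |x. x \<in> X})"
    by (subst tau_eq) (simp add: Un_ac)
  moreover have "\<exists>U V. openin tau U \<and> openin tau V \<and> x \<in> U \<and> y \<in> V \<and> (\<forall>s\<in>U. \<forall>t\<in>V. t \<sqsubset> s)"
    if "y \<sqsubset> x" for x y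
    using lt_continuous[OF that] by blast
  ultimately show ?thesis
    using tournament_reverse
    by (simp add: tournament_space_def tournament_space_axioms_def)
qed

lemma topspace_tau [simp]: "topspace tau = X"
  by (subst tau_eq) (use lt_in in \<open>auto simp: topology_generated_by_topspace\<close>)

lemma clopenin_X: "clopenin tau X"
  using clopenin_topspace[of tau] by simp

lemma openin_below: "openin tau {y. y \<sqsubset> x}"
proof (cases "x \<in> X")
  case True
  then show ?thesis by (subst tau_eq) (rule topology_generated_by_Basis, blast)
next
  case False
  then have "{y. y \<sqsubset> x} = {}" using lt_in by blast
  then show ?thesis by simp
qed

lemma openin_above: "openin tau {y. x \<sqsubset> y}"
proof (cases "x \<in> X")
  case True
  then show ?thesis by (subst tau_eq) (rule topology_generated_by_Basis, blast)
next
  case False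
  then have "{y. x \<sqsubset> y} = {}" using lt_in by blast
  then show ?thesis by simp
qed

lemma closedin_not_above: "closedin tau (X - {y. x \<sqsubset> y})"
  by (metis openin_above closedin_diff closedin_topspace topspace_tau)

lemma closedin_not_below: "closedin tau (X - {y. y \<sqsubset> x})"
  by (metis openin_below closedin_diff closedin_topspace topspace_tau)

text \<open>
  The point \<open>u\<close> is the only possible boundary point of the ray, and it is not in \<open>K\<close>.
\<close>
lemma clopenin_below:
  assumes "clopenin tau K" "u \<in> X" "u \<notin> K"
  shows "clopenin tau (K \<inter> {y. y \<sqsubset> u})"
proof -
  have "K \<inter> {y. y \<sqsubset> u} = K - {y. u \<sqsubset> y}"
    using clopenin_subset[OF assms(1)] assms lt_total lt_asym by auto
  then show ?thesis
    using assms(1) openin_below[of u] openin_above[of u]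
    unfolding clopenin_def by (metis closedin_diff openin_Int)
qed

lemma clopenin_above:
  assumes "clopenin tau K" "u \<in> X" "u \<notin> K"
  shows "clopenin tau (K \<inter> {y. u \<sqsubset> y})"
proof -
  have "K \<inter> {y. u \<sqsubset> y} = K - {y. y \<sqsubset> u}"
    using clopenin_subset[OF assms(1)] assms lt_total lt_asym by auto
  then show ?thesis
    using assms(1) openin_below[of u] openin_above[of u]
    unfolding clopenin_def by (metis closedin_diff openin_Int)
qed

text \<open>
  The two open rays intersect in the same set as the corresponding closed rays, since \<open>b \<sqsubset> c\<close> keeps
  both end points \<open>b\<close> and \<open>c\<close> out of that intersection.
\<close>
lemma cycle_separated:
  assumes "a \<sqsubset> b" "b \<sqsubset> c" "c \<sqsubset> a"
  shows "sep a b"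
proof -
  have "{y. y \<sqsubset> b} \<inter> {y. c \<sqsubset> y} = (X - {y. b \<sqsubset> y}) \<inter> (X - {y. y \<sqsubset> c})"
  proof (intro set_eqI iffI)
    fix y assume "y \<in> (X - {y. b \<sqsubset> y}) \<inter> (X - {y. y \<sqsubset> c})"
    then have y: "y \<in> X" "\<not> b \<sqsubset> y" "\<not> y \<sqsubset> c" by auto
    then have "y \<noteq> b" "y \<noteq> c" using assms(2) by auto
    then show "y \<in> {y. y \<sqsubset> b} \<inter> {y. c \<sqsubset> y}"
      using y lt_total lt_in[OF assms(2)] by blast
  qed (use lt_in lt_asym in blast)
  then have "clopenin tau ({y. y \<sqsubset> b} \<inter> {y. c \<sqsubset> y})"
    unfolding clopenin_def
    using openin_Int[OF openin_below openin_above] closedin_Int[OF closedin_not_above closedin_not_below]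
    by metis
  then show ?thesis using assms unfolding clopen_separated_def by fastforce
qed

lemma sep_sym: "sep x y \<Longrightarrow> y \<in> X \<Longrightarrow> sep y x"
  using clopen_separated_sym by fastforce

lemma sep_trans: "\<not> sep x y \<Longrightarrow> \<not> sep y z \<Longrightarrow> \<not> sep x z"
  unfolding clopen_separated_def by blast

lemma sep_cong: "sep z x \<Longrightarrow> \<not> sep x y \<Longrightarrow> x \<in> X \<Longrightarrow> y \<in> X \<Longrightarrow> z \<in> X \<Longrightarrow> sep z y"
  using sep_trans sep_sym by meson

text \<open>
  A point sees all points of a quasi-component that does not contain it on the same side: otherwise
  its ray would cut that quasi-component by a clopen set.
\<close>
lemma lt_class:
  assumes "z \<sqsubset> x" "sep z x" "\<not> sep x y" "y \<in> X"
  shows "z \<sqsubset> y"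
proof (rule ccontr)
  assume "\<not> z \<sqsubset> y"
  have zx: "z \<in> X" "x \<in> X" using assms lt_in by auto
  obtain K where K: "clopenin tau K" "x \<in> K" "z \<notin> K"
    using sep_sym[OF assms(2)] zx unfolding clopen_separated_def by blast
  have "y \<in> K" using K assms unfolding clopen_separated_def by blast
  then have "y \<sqsubset> z" using \<open>\<not> z \<sqsubset> y\<close> K lt_total zx assms(4) by metis
  have "sep y x"
    unfolding clopen_separated_def
    using clopenin_below[OF K(1) zx(1) K(3)] \<open>y \<in> K\<close> \<open>y \<sqsubset> z\<close> lt_asym[OF assms(1)] by blast
  then show False using assms sep_sym zx by blast
qed

lemma gt_class:
  assumes "x \<sqsubset> z" "sep z x" "\<not> sep x y" "y \<in> X"
  shows "y \<sqsubset> z"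
proof -
  have "z \<in> X" "x \<in> X" using assms lt_in by auto
  then have "sep z y" using sep_cong assms by blast
  then have "z \<noteq> y" unfolding clopen_separated_def by blast
  moreover have "\<not> z \<sqsubset> y" 
    using lt_class[of z y x] \<open>sep z y\<close> sep_sym[of y x] assms lt_asym \<open>x \<in> X\<close> \<open>y \<in> X\<close>
    by (meson sep_sym)
  ultimately show ?thesis using lt_total \<open>z \<in> X\<close> assms(4) by blast
qed

text \<open>
  Only the part of \<open>R\<close> above \<open>b\<close> is controlled. This suffices for clopen neighbourhoods even if the
  quasi-component of \<open>b\<close> is not contained in \<open>U\<close>. The proof is by induction on the generation of \<open>U\<close>:
  a ray that bounds \<open>b\<close> at a separated point may be replaced by a clopen set, and a
  ray starting in the quasi-component of \<open>b\<close> contains everything above \<open>b\<close> by \<open>gt_class\<close>.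
\<close>
lemma nbhd_above_class_max:
  assumes "openin tau U" "b \<in> U" and max: "\<And>u. b \<sqsubset> u \<Longrightarrow> sep b u"
  shows "\<exists>R. clopenin tau R \<and> b \<in> R \<and> (\<forall>y\<in>R. b \<sqsubset> y \<longrightarrow> y \<in> U)"
proof -
  have bX: "b \<in> X" using assms openin_subset by fastforce
  have "generate_topology_on ({X} \<union> {{y. y \<sqsubset> x} |x. x \<in> X} \<union> {{y. x \<sqsubset> y} |x. x \<in> X}) U"
    using assms(1) by (subst (asm) tau_eq) (simp add: openin_topology_generated_by_iff)
  then show ?thesis using assms(2)
  proof (induction rule: generate_topology_on.induct)
    case Empty
    then show ?case by simp
  next
    case (Int U V)
    then obtain R S where "clopenin tau R" "b \<in> R" "\<forall>y\<in>R. b \<sqsubset> y \<longrightarrow> y \<in> U"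
       "clopenin tau S" "b \<in> S" "\<forall>y\<in>S. b \<sqsubset> y \<longrightarrow> y \<in> V" by auto
    then show ?case using clopenin_Int[of tau R S] by blast
  next
    case (UN \<U>)
    then show ?case by (metis Union_iff)
  next
    case (Basis S)
    then consider "S = X" | u where "u \<in> X" "S = {y. y \<sqsubset> u}" | v where "v \<in> X" "S = {y. v \<sqsubset> y}"
      by blast
    then show ?case
    proof cases
      case 1
      show ?thesis
        unfolding \<open>S = X\<close> using clopenin_X bX by (intro exI[of _ X]) blast
    next
      case 2
      then have "b \<sqsubset> u" using Basis(2) by simp
      then obtain K where "clopenin tau K" "b \<in> K" "u \<notin> K"
        using max[of u] unfolding clopen_separated_def by blast
      then show ?thesis using clopenin_below[of K u] 2 \<open>b \<sqsubset> u\<close> by blast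
    next
      case 3
      then have "v \<sqsubset> b" using Basis(2) by simp
      show ?thesis
      proof (cases "sep b v")
        case True
        then obtain K where "clopenin tau K" "b \<in> K" "v \<notin> K"
          unfolding clopen_separated_def by blast
        then show ?thesis using clopenin_above[of K v] 3 \<open>v \<sqsubset> b\<close> by blast
      next
        case False
        have "v \<sqsubset> y" if "b \<sqsubset> y" for y
          using gt_class[OF that _ False \<open>v \<in> X\<close>] sep_sym[OF max[OF that]] lt_in[OF that] by blast
        then show ?thesis using clopenin_X bX 3(2) by blast
      qed
    qed
  qed
qed

text \<open>
  Quasi-components need not be compact, but a property \<open>P\<close> that holds locally at each of their points
  extends to the points of a clopen neighbourhood that lie above the quasi-component. For if the
  latter has a largest element, then only the local assumption at that point matters; and if
  it has none, then the set \<open>B\<close> of all points above it is clopen and can be removed. The predicate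
  \<open>N\<close> abstracts from the kind of sets \<open>V\<close> over which \<open>P\<close> is to hold uniformly: open
  neighbourhoods of a point in one application, clopen ones in the other.
\<close>
lemma uniform_nbhd_above:
  assumes r: "r \<in> X" and N: "N V0"
    and loc: "\<And>b. b \<in> X \<Longrightarrow> \<not> sep b r \<Longrightarrow>
          \<exists>U V. openin tau U \<and> b \<in> U \<and> N V \<and> (\<forall>s\<in>U. \<forall>t\<in>V. P s t)"
  shows "\<exists>R V. clopenin tau R \<and> r \<in> R \<and> N V \<and>
           (\<forall>y\<in>R. sep y r \<longrightarrow> r \<sqsubset> y \<longrightarrow> (\<forall>t\<in>V. P y t))"
proof (cases "\<exists>b\<in>X. \<not> sep b r \<and> (\<forall>u. b \<sqsubset> u \<longrightarrow> sep b u)")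
  case True
  then obtain b where b: "b \<in> X" "\<not> sep b r" "\<And>u. b \<sqsubset> u \<Longrightarrow> sep b u" by blast
  obtain U V where U: "openin tau U" "b \<in> U" "N V" "\<forall>s\<in>U. \<forall>t\<in>V. P s t"
    using loc[OF b(1,2)] by blast
  obtain R where R: "clopenin tau R" "b \<in> R" "\<And>y. y \<in> R \<Longrightarrow> b \<sqsubset> y \<Longrightarrow> y \<in> U"
    using nbhd_above_class_max[OF U(1,2) b(3)] by blast
  have rb: "\<not> sep r b" using b(1,2) r sep_sym by blast
  have "r \<in> R" using R(1,2) b(2) unfolding clopen_separated_def by blast
  moreover have "\<forall>t\<in>V. P y t" if "y \<in> R" "sep y r" "r \<sqsubset> y" for y
    using gt_class[OF that(3,2) rb b(1)] R(3)[OF that(1)] U(4) by blast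
  ultimately show ?thesis using R(1) U(3) by blast
next
  case False
  \<comment> \<open>No largest element: the whole part above the quasi-component is split off.\<close>
  define B where "B = {y. r \<sqsubset> y \<and> sep y r}"
  have "openin tau B"
  proof (subst openin_subopen, intro ballI)
    fix y assume "y \<in> B"
    then have y: "r \<sqsubset> y" "sep y r" unfolding B_def by auto
    then obtain K where K: "clopenin tau K" "y \<in> K" "r \<notin> K" unfolding clopen_separated_def by blast
    have "openin tau (K \<inter> {v. r \<sqsubset> v})" using K(1) openin_above clopenin_def openin_Int by blast
    moreover have "K \<inter> {v. r \<sqsubset> v} \<subseteq> B" using K unfolding B_def clopen_separated_def by blast
    ultimately show "\<exists>T. openin tau T \<and> y \<in> T \<and> T \<subseteq> B" using K y by blast
  qed
  have "openin tau (X - B)"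
  proof (subst openin_subopen, intro ballI)
    fix y assume y: "y \<in> X - B"
    show "\<exists>T. openin tau T \<and> y \<in> T \<and> T \<subseteq> X - B"
    proof (cases "sep y r")
      case True
      then have "y \<noteq> r" unfolding clopen_separated_def by blast
      then have "y \<sqsubset> r" using y True r lt_total unfolding B_def by blast
      moreover have "{v. v \<sqsubset> r} \<subseteq> X - B" using lt_in lt_asym unfolding B_def by blast
      ultimately show ?thesis using openin_below by blast
    next
      case yr: False
      then obtain u where u: "y \<sqsubset> u" "\<not> sep y u" using False y by blast
      have uX: "u \<in> X" using u lt_in by blast
      have ur: "\<not> sep u r" using u yr y uX sep_trans sep_sym by blast
      have "v \<notin> B" if "v \<sqsubset> u" for v
      proof
        assume "v \<in> B"
        then have v: "r \<sqsubset> v" "sep v r" unfolding B_def by auto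
        have "\<not> sep r u" using ur sep_sym uX by blast
        then have "u \<sqsubset> v" using gt_class[OF v] uX by blast
        then show False using that lt_asym by blast
      qed
      then have "{v. v \<sqsubset> u} \<subseteq> X - B" using lt_in by blast
      then show ?thesis using u openin_below by blast
    qed
  qed
  then have "clopenin tau (X - B)"
    using \<open>openin tau B\<close> unfolding clopenin_def
    by (metis closedin_diff closedin_topspace topspace_tau)
  then show ?thesis using N r unfolding B_def by auto
qed

interpretation rev: tournament_space X "\<lambda>x y. y \<sqsubset> x" tau
  by (rule tournament_space_reverse)

text \<open>
  A clopen neighbourhood of \<open>r\<close> consists of points in the quasi-component of \<open>r\<close>, above it and below
  it; the last part is the previous lemma for the reversed tournament.
\<close>
lemma uniform_clopen_nbhd:
  assumes r: "r \<in> X" and N: "N V0" and N_Int: "\<And>V V'. N V \<Longrightarrow> N V' \<Longrightarrow> N (V \<inter> V')"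
    and whole: "\<And>y t. y \<in> X \<Longrightarrow> \<not> sep y r \<Longrightarrow> t \<in> V0 \<Longrightarrow> P y t"
    and loc: "\<And>b. b \<in> X \<Longrightarrow> \<not> sep b r \<Longrightarrow>
          \<exists>U V. openin tau U \<and> b \<in> U \<and> N V \<and> (\<forall>s\<in>U. \<forall>t\<in>V. P s t)"
  shows "\<exists>R V. clopenin tau R \<and> r \<in> R \<and> N V \<and> (\<forall>y\<in>R. \<forall>t\<in>V. P y t)"
proof -
  obtain R1 V1 where 1: "clopenin tau R1" "r \<in> R1" "N V1"
      "\<forall>y\<in>R1. sep y r \<longrightarrow> r \<sqsubset> y \<longrightarrow> (\<forall>t\<in>V1. P y t)"
    using uniform_nbhd_above[OF r, of N V0 P, OF N loc] by blast
  obtain R2 V2 where 2: "clopenin tau R2" "r \<in> R2" "N V2"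
      "\<forall>y\<in>R2. sep y r \<longrightarrow> y \<sqsubset> r \<longrightarrow> (\<forall>t\<in>V2. P y t)"
    using rev.uniform_nbhd_above[OF r, of N V0 P, OF N loc] by blast
  have "P y t" if y: "y \<in> R1 \<inter> R2" and t: "t \<in> V0 \<inter> (V1 \<inter> V2)" for y t
  proof (cases "sep y r")
    case True
    have "y \<in> X" using y clopenin_subset[OF 1(1)] by auto
    moreover have "y \<noteq> r" using True unfolding clopen_separated_def by blast
    ultimately have "y \<sqsubset> r \<or> r \<sqsubset> y" using lt_total r by blast
    then show ?thesis using 1(4) 2(4) y t True by blast
  next
    case False
    have "y \<in> X" using y clopenin_subset[OF 1(1)] by auto
    then show ?thesis using whole False t by blast
  qed
  moreover have "clopenin tau (R1 \<inter> R2)" "r \<in> R1 \<inter> R2" "N (V0 \<inter> (V1 \<inter> V2))"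
    using 1 2 N N_Int clopenin_Int by auto
  ultimately show ?thesis by blast
qed

lemma separated_clopen_open:
  assumes "r \<sqsubset> d" "sep r d"
  shows "\<exists>R V. clopenin tau R \<and> r \<in> R \<and> openin tau V \<and> d \<in> V \<and> (\<forall>y\<in>R. \<forall>t\<in>V. y \<sqsubset> t)"
proof -
  have rd: "r \<in> X" "d \<in> X" using assms lt_in by auto
  obtain K where K: "clopenin tau K" "d \<in> K" "r \<notin> K"
    using sep_sym[OF assms(2) rd(2)] unfolding clopen_separated_def by blast
  have "\<exists>R V. clopenin tau R \<and> r \<in> R \<and> (openin tau V \<and> d \<in> V) \<and> (\<forall>y\<in>R. \<forall>t\<in>V. y \<sqsubset> t)"
  proof (rule uniform_clopen_nbhd[of r "\<lambda>V. openin tau V \<and> d \<in> V" "K \<inter> {t. r \<sqsubset> t}" "(\<sqsubset>)"])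
    show "openin tau (K \<inter> {t. r \<sqsubset> t}) \<and> d \<in> K \<inter> {t. r \<sqsubset> t}"
      using K assms openin_above clopenin_def openin_Int by blast
  next
    fix y t assume y: "y \<in> X" "\<not> sep y r" and t: "t \<in> K \<inter> {t. r \<sqsubset> t}"
    have "sep t r" using t K unfolding clopen_separated_def by blast
    moreover have "\<not> sep r y" using y sep_sym[of r y] by blast
    ultimately show "y \<sqsubset> t" using gt_class[of r t y] t y(1) by simp
  next
    fix b assume b: "b \<in> X" "\<not> sep b r"
    have "sep d r" using sep_sym[OF assms(2) rd(2)] .
    moreover have "\<not> sep r b" using sep_sym[of r b] b by blast
    ultimately have "b \<sqsubset> d" using gt_class[OF assms(1)] b(1) by simp
    from lt_continuous[OF this]
    show "\<exists>U V. openin tau U \<and> b \<in> U \<and> (openin tau V \<and> d \<in> V) \<and> (\<forall>s\<in>U. \<forall>t\<in>V. s \<sqsubset> t)"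
      by (elim exE conjE) (intro exI conjI)
  qed (use rd in \<open>auto simp: openin_Int\<close>)
  then show ?thesis by (simp only: conj_assoc)
qed

text \<open>
  Clopen neighbourhoods on both sides are obtained one after the other: the clopen set \<open>R0\<close> for \<open>r\<close>
  found with open neighbourhoods of \<open>d\<close> serves as the uniform set in the argument for \<open>d\<close>.
\<close>
lemma separated_clopen_clopen:
  assumes "r \<sqsubset> d" "sep r d"
  shows "\<exists>R D. clopenin tau R \<and> r \<in> R \<and> clopenin tau D \<and> d \<in> D \<and> (\<forall>y\<in>R. \<forall>t\<in>D. y \<sqsubset> t)"
proof -
  have rd: "r \<in> X" "d \<in> X" using assms lt_in by auto
  obtain R0 V0 where 0: "clopenin tau R0" "r \<in> R0" "d \<in> V0" "\<forall>y\<in>R0. \<forall>t\<in>V0. y \<sqsubset> t"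
    using separated_clopen_open[OF assms] by (elim exE conjE)
  have below: "t \<sqsubset> d" if "t \<in> R0" for t using 0(3,4) that by blast
  have dR0: "d \<notin> R0" using below[of d] by auto
  have "\<exists>D R. clopenin tau D \<and> d \<in> D \<and> (clopenin tau R \<and> r \<in> R) \<and> (\<forall>y\<in>D. \<forall>t\<in>R. t \<sqsubset> y)"
  proof (rule uniform_clopen_nbhd[of d "\<lambda>R. clopenin tau R \<and> r \<in> R" R0 "\<lambda>s t. t \<sqsubset> s"])
    fix y t assume y: "y \<in> X" "\<not> sep y d" and t: "t \<in> R0"
    have "sep t d" using t 0(1) dR0 unfolding clopen_separated_def by blast
    moreover have "\<not> sep d y" using y sep_sym[of d y] by blast
    ultimately show "t \<sqsubset> y" using lt_class[OF below[OF t]] y(1) by simp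
  next
    fix b assume b: "b \<in> X" "\<not> sep b d"
    have db: "\<not> sep d b" using sep_sym[of d b] b by blast
    obtain R V where "clopenin tau R" "r \<in> R" "openin tau V" "b \<in> V" "\<forall>y\<in>R. \<forall>t\<in>V. y \<sqsubset> t"
      using separated_clopen_open[OF lt_class[OF assms db b(1)] sep_cong[OF assms(2) db rd(2) b(1) rd(1)]]
      by (elim exE conjE)
    then show "\<exists>U V. openin tau U \<and> b \<in> U \<and> (clopenin tau V \<and> r \<in> V) \<and> (\<forall>s\<in>U. \<forall>t\<in>V. t \<sqsubset> s)"
      by (intro exI[of _ V] exI[of _ R]) simp
  qed (use rd 0 in \<open>auto simp: clopenin_Int\<close>)
  then obtain D R where "clopenin tau D" "d \<in> D" "clopenin tau R" "r \<in> R" "\<forall>y\<in>D. \<forall>t\<in>R. t \<sqsubset> y"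
    by (elim exE conjE)
  then show ?thesis by (intro exI[of _ R] exI[of _ D]) simp
qed

end

section \<open>Cycles cannot accumulate\<close>

text \<open>
  Feeble compactness (every sequence of nonempty open sets has a cluster point) is assumed for clopen
  sets only. The index set \<open>N\<close> allows for subsequences.
\<close>
locale feebly_compact_tournament_space = tournament_space +
  assumes cluster_point: "\<And>(N :: nat set) G. infinite N \<Longrightarrow>
      \<forall>n\<in>N. clopenin tau (G n) \<and> G n \<noteq> {} \<Longrightarrow>
      \<exists>p\<in>X. \<forall>U. openin tau U \<longrightarrow> p \<in> U \<longrightarrow> infinite {n \<in> N. G n \<inter> U \<noteq> {}}"
begin

lemma feebly_compact_reverse: "feebly_compact_tournament_space X (\<lambda>x y. y \<sqsubset> x) tau"
  using tournament_space_reverse cluster_point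
  by (simp add: feebly_compact_tournament_space_def feebly_compact_tournament_space_axioms_def)

text \<open>
  If \<open>c \<sqsubset> d\<close>, then by continuity members near \<open>c\<close> would lie below members near \<open>d\<close>, also when the
  latter come first in the sequence.
\<close>
lemma increasing_cluster_points:
  fixes N :: "nat set"
  assumes incr: "\<And>m n y t. m \<in> N \<Longrightarrow> n \<in> N \<Longrightarrow> m < n \<Longrightarrow> y \<in> Z m \<Longrightarrow> t \<in> Z n \<Longrightarrow> y \<sqsubset> t"
    and c: "\<And>U. openin tau U \<Longrightarrow> c \<in> U \<Longrightarrow> infinite {n \<in> N. Z n \<inter> U \<noteq> {}}"
    and d: "\<And>U. openin tau U \<Longrightarrow> d \<in> U \<Longrightarrow> infinite {n \<in> N. Z n \<inter> U \<noteq> {}}"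
  shows "\<not> c \<sqsubset> d"
proof
  assume "c \<sqsubset> d"
  obtain U V where UV: "openin tau U" "openin tau V" "c \<in> U" "d \<in> V" "\<forall>s\<in>U. \<forall>t\<in>V. s \<sqsubset> t"
    using lt_continuous[OF \<open>c \<sqsubset> d\<close>] by blast
  obtain m where m: "m \<in> N" "Z m \<inter> V \<noteq> {}"
    using d[OF UV(2,4)] infinite_imp_nonempty by blast
  obtain n where n: "n > m" "n \<in> N" "Z n \<inter> U \<noteq> {}"
    using c[OF UV(1,3)] unfolding infinite_nat_iff_unbounded by blast
  obtain y t where "y \<in> Z m" "y \<in> V" "t \<in> Z n" "t \<in> U" using m n by blast
  then have "y \<sqsubset> t" "t \<sqsubset> y" using incr[OF m(1) n(2,1)] UV(5) by blast+
  then show False using lt_asym by blast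
qed

text \<open>
  A cluster point of any subsequence is a cluster point of the whole sequence, and there is just one
  such point. So no subsequence stays away from it.
\<close>
lemma increasing_clopen_converges:
  fixes N :: "nat set"
  assumes N: "infinite N" and Z: "\<forall>n\<in>N. clopenin tau (Z n) \<and> Z n \<noteq> {}"
    and incr: "\<And>m n y t. m \<in> N \<Longrightarrow> n \<in> N \<Longrightarrow> m < n \<Longrightarrow> y \<in> Z m \<Longrightarrow> t \<in> Z n \<Longrightarrow> y \<sqsubset> t"
  shows "\<exists>d\<in>X. \<forall>U. openin tau U \<longrightarrow> d \<in> U \<longrightarrow> finite {n \<in> N. Z n \<inter> U = {}}"
proof -
  obtain d where d: "d \<in> X" "\<And>U. openin tau U \<Longrightarrow> d \<in> U \<Longrightarrow> infinite {n \<in> N. Z n \<inter> U \<noteq> {}}"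
    using cluster_point[OF N Z] by blast
  have "finite {n \<in> N. Z n \<inter> U = {}}" if U: "openin tau U" "d \<in> U" for U
  proof (rule ccontr)
    define M where "M = {n \<in> N. Z n \<inter> U = {}}"
    assume "infinite {n \<in> N. Z n \<inter> U = {}}"
    then have M: "infinite M" unfolding M_def .
    have ZM: "\<forall>n\<in>M. clopenin tau (Z n) \<and> Z n \<noteq> {}" using Z unfolding M_def by blast
    obtain c where c: "c \<in> X" "\<And>V. openin tau V \<Longrightarrow> c \<in> V \<Longrightarrow> infinite {n \<in> M. Z n \<inter> V \<noteq> {}}"
      using cluster_point[OF M ZM] by blast
    have cN: "infinite {n \<in> N. Z n \<inter> V \<noteq> {}}" if "openin tau V" "c \<in> V" for V
      using c(2)[OF that] by (rule infinite_super[rotated]) (auto simp: M_def)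
    have "{n \<in> M. Z n \<inter> U \<noteq> {}} = {}" unfolding M_def by blast
    then have "c \<noteq> d" using c(2)[OF U(1)] U(2) by (metis finite.emptyI)
    moreover have "\<not> c \<sqsubset> d" by (rule increasing_cluster_points[OF incr cN d(2)])
    moreover have "\<not> d \<sqsubset> c" by (rule increasing_cluster_points[OF incr d(2) cN])
    ultimately show False using lt_total[OF c(1) d(1)] by blast
  qed
  then show ?thesis using d(1) by blast
qed

interpretation rev: feebly_compact_tournament_space X "\<lambda>x y. y \<sqsubset> x" tau
  by (rule feebly_compact_reverse)

text \<open>
  The sets \<open>K n\<close> shrink around the point at which cycles accumulate. Because of \<open>ZK\<close> a
  subsequence of the sets \<open>Z n\<close> is monotone, hence converges to some \<open>d\<close>. For a cluster point \<open>c\<close> of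
  the corresponding sets \<open>Q n\<close>, assumption \<open>KQ\<close> excludes \<open>c \<sqsubset> d\<close> and assumption \<open>QZ\<close> excludes
  \<open>d \<sqsubset> c\<close>. Convergence to \<open>d\<close>, and not just clustering, is needed to have \<open>Z n\<close> near \<open>d\<close> and
  \<open>Q n\<close> near \<open>c\<close> for the same \<open>n\<close>.
\<close>
lemma no_nested_cycle_sequence:
  assumes Z: "\<And>n. clopenin tau (Z n) \<and> Z n \<noteq> {}" and Q: "\<And>n. clopenin tau (Q n) \<and> Q n \<noteq> {}"
    and K: "\<And>n. clopenin tau (K n)" "\<And>n. K (Suc n) \<subseteq> K n"
    and ZKA: "\<And>n. Z n \<subseteq> K n \<inter> A" and QB: "\<And>n. Q n \<subseteq> B"
    and AB: "closedin tau A" "closedin tau B" "A \<inter> B = {}"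
    and QZ: "\<And>n y t. y \<in> Q n \<Longrightarrow> t \<in> Z n \<Longrightarrow> y \<sqsubset> t"
    and KQ: "\<And>n y t. y \<in> K (Suc n) \<Longrightarrow> t \<in> Q n \<Longrightarrow> y \<sqsubset> t"
    and ZK: "\<And>n. (\<forall>y\<in>Z n. \<forall>t\<in>K (Suc n). y \<sqsubset> t) \<or> (\<forall>y\<in>Z n. \<forall>t\<in>K (Suc n). t \<sqsubset> y)"
  shows False
proof -
  have Kmono: "K n \<subseteq> K m" if "m \<le> n" for m n
    using lift_Suc_antimono_le[of K, OF K(2) that] .
  have later: "t \<in> K (Suc m)" if "t \<in> Z n" "m < n" for t m n
    using Kmono[of "Suc m" n] ZKA that by auto
  define up where "up = {n. \<forall>y\<in>Z n. \<forall>t\<in>K (Suc n). y \<sqsubset> t}"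
  obtain N where N: "infinite N" and conv: "\<exists>d\<in>X. \<forall>U. openin tau U \<longrightarrow> d \<in> U \<longrightarrow> finite {n \<in> N. Z n \<inter> U = {}}"
  proof (cases "infinite up")
    case True
    have "y \<sqsubset> t" if "m \<in> up" "m < n" "y \<in> Z m" "t \<in> Z n" for m n y t
      using that(1,3) later[OF that(4,2)] unfolding up_def by blast
    then show ?thesis
      using that[OF True] increasing_clopen_converges[OF True, of Z] Z by simp
  next
    case False
    then have inf: "infinite (- up)" by (simp add: Compl_eq_Diff_UNIV)
    have "t \<sqsubset> y" if "m \<in> - up" "m < n" "y \<in> Z m" "t \<in> Z n" for m n y t
      using that(1,3) later[OF that(4,2)] ZK[of m] unfolding up_def by blast
    then show ?thesis
      using that[OF inf] rev.increasing_clopen_converges[OF inf, of Z] Z by simp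
  qed
  obtain d where d: "d \<in> X" "\<And>U. openin tau U \<Longrightarrow> d \<in> U \<Longrightarrow> finite {n \<in> N. Z n \<inter> U = {}}"
    using conv by blast
  obtain c where c: "c \<in> X" "\<And>U. openin tau U \<Longrightarrow> c \<in> U \<Longrightarrow> infinite {n \<in> N. Q n \<inter> U \<noteq> {}}"
    using cluster_point[OF N, of Q] Q by blast
  have meets: "\<exists>n>m. n \<in> N \<and> Z n \<inter> U \<noteq> {}" if "openin tau U" "d \<in> U" for U m
  proof -
    have "infinite (N - {n \<in> N. Z n \<inter> U = {}})" using N d(2)[OF that] by simp
    then show ?thesis unfolding infinite_nat_iff_unbounded by blast
  qed
  have compl: "openin tau (X - S)" if "closedin tau S" for S
    using that by (metis openin_diff openin_topspace topspace_tau)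
  have "d \<in> A" using meets[OF compl[OF AB(1)]] d(1) ZKA by blast
  have "c \<in> B"
  proof (rule ccontr)
    assume "c \<notin> B"
    then have "infinite {n \<in> N. Q n \<inter> (X - B) \<noteq> {}}" using c(1) c(2)[OF compl[OF AB(2)]] by blast
    moreover have "{n \<in> N. Q n \<inter> (X - B) \<noteq> {}} = {}" using QB by blast
    ultimately show False by simp
  qed
  have dK: "d \<in> K (Suc n)" for n
  proof (rule ccontr)
    assume "d \<notin> K (Suc n)"
    then obtain k where "k > n" "Z k \<inter> (X - K (Suc n)) \<noteq> {}"
      using meets[of "X - K (Suc n)" n] compl K(1) d(1) unfolding clopenin_def by blast
    then show False using later by blast
  qed
  have "\<not> c \<sqsubset> d"
  proof
    assume "c \<sqsubset> d"
    then have "infinite {n \<in> N. Q n \<inter> {y. y \<sqsubset> d} \<noteq> {}}" using c(2)[OF openin_below] by simp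
    moreover have "{n \<in> N. Q n \<inter> {y. y \<sqsubset> d} \<noteq> {}} = {}" using KQ[OF dK] by (auto dest: lt_asym)
    ultimately show False by simp
  qed
  moreover have "c \<noteq> d" using \<open>d \<in> A\<close> \<open>c \<in> B\<close> AB(3) by blast
  ultimately have "d \<sqsubset> c" using lt_total[OF c(1) d(1)] by blast
  obtain U V where UV: "openin tau U" "openin tau V" "d \<in> U" "c \<in> V" "\<forall>s\<in>U. \<forall>t\<in>V. s \<sqsubset> t"
    using lt_continuous[OF \<open>d \<sqsubset> c\<close>] by blast
  have "infinite ({n \<in> N. Q n \<inter> V \<noteq> {}} - {n \<in> N. Z n \<inter> U = {}})"
    using c(2)[OF UV(2,4)] d(2)[OF UV(1,3)] by simp
  then obtain n where "Q n \<inter> V \<noteq> {}" "Z n \<inter> U \<noteq> {}"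
    using infinite_imp_nonempty by blast
  then obtain y t where "y \<in> Q n" "y \<in> V" "t \<in> Z n" "t \<in> U" by blast
  then have "y \<sqsubset> t" "t \<sqsubset> y" using QZ UV(5) by blast+
  then show False using lt_asym by blast
qed

text \<open>
  The clopen sets around the points \<open>z\<close> of the cycles have to stay uniformly away from \<open>w\<close> and the
  points above it, hence the closed set \<open>A\<close>. If \<open>x\<close>
  and \<open>w\<close> are separated, a clopen neighbourhood of \<open>x\<close> below \<open>w\<close> will do. Otherwise both
  belong to one quasi-component, \<open>z\<close> is below it, and the points that are below or equal to both
  \<open>x\<close> and \<open>w\<close> form a closed set; it misses \<open>w\<close> because of \<open>x \<sqsubset> w\<close>.
\<close>
lemma clopen_nbhds_away:
  assumes "x \<sqsubset> w"
  shows "\<exists>K A. clopenin tau K \<and> x \<in> K \<and> closedin tau A \<and> A \<subseteq> {y. y \<sqsubset> w} \<and>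
           (\<forall>z\<in>K. z \<sqsubset> w \<longrightarrow> sep z w \<longrightarrow> (\<exists>Z. clopenin tau Z \<and> z \<in> Z \<and> Z \<subseteq> A))"
proof (cases "sep x w")
  case True
  have wX: "w \<in> X" using assms lt_in by blast
  obtain K where K: "clopenin tau K" "x \<in> K" "w \<notin> K" using True unfolding clopen_separated_def by blast
  have "clopenin tau (K \<inter> {y. y \<sqsubset> w})" using clopenin_below[OF K(1) wX K(3)] .
  then show ?thesis
    using K(2) assms by (intro exI[of _ "K \<inter> {y. y \<sqsubset> w}"]) (auto simp: clopenin_def)
next
  case False
  have X: "x \<in> X" "w \<in> X" using assms lt_in by auto
  define A where "A = (X - {y. x \<sqsubset> y}) \<inter> (X - {y. w \<sqsubset> y})"
  have "closedin tau A" unfolding A_def using closedin_not_above closedin_Int by blast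
  moreover have "A \<subseteq> {y. y \<sqsubset> w}" using assms X lt_total unfolding A_def by blast
  moreover have "\<exists>Z. clopenin tau Z \<and> z \<in> Z \<and> Z \<subseteq> A" if z: "z \<sqsubset> w" "sep z w" for z
  proof -
    have wx: "\<not> sep w x" using False sep_sym X by blast
    have zx: "z \<sqsubset> x" using lt_class[OF z wx X(1)] .
    obtain K where K: "clopenin tau K" "z \<in> K" "w \<notin> K" using z(2) unfolding clopen_separated_def by blast
    have xK: "x \<notin> K" using False K unfolding clopen_separated_def by blast
    have "clopenin tau ((K \<inter> {y. y \<sqsubset> x}) \<inter> {y. y \<sqsubset> w})"
      using clopenin_below[OF clopenin_below[OF K(1) X(1) xK] X(2)] K(3) by blast
    moreover have "(K \<inter> {y. y \<sqsubset> x}) \<inter> {y. y \<sqsubset> w} \<subseteq> A"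
      unfolding A_def using lt_in lt_asym by blast
    ultimately show ?thesis using K(2) zx z(1) by blast
  qed
  ultimately show ?thesis using clopenin_X X(1) by blast
qed

text \<open>
  One round of the construction. The points \<open>z\<close>, \<open>w\<close>, \<open>q\<close> are pairwise separated as they form a
  cycle. Moreover \<open>x\<close> is separated from \<open>q\<close> and from \<open>z\<close>: if \<open>x\<close> and \<open>q\<close> were in one
  quasi-component, then \<open>x \<sqsubset> w\<close> would imply \<open>q \<sqsubset> w\<close>; if \<open>x\<close> and \<open>z\<close> were, then \<open>x \<sqsubset> q\<close> would imply
  \<open>z \<sqsubset> q\<close>.
\<close>
lemma cycle_step:
  assumes A: "\<And>z. z \<in> K0 \<Longrightarrow> z \<sqsubset> w \<Longrightarrow> sep z w \<Longrightarrow> \<exists>Z. clopenin tau Z \<and> z \<in> Z \<and> Z \<subseteq> A"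
    and xw: "x \<sqsubset> w" and K: "clopenin tau K" "x \<in> K"
    and z: "z \<in> K" "z \<in> K0" and cyc: "z \<sqsubset> w" "w \<sqsubset> q" "q \<sqsubset> z" and xq: "x \<sqsubset> q"
  shows "\<exists>Z Q K'. clopenin tau Z \<and> Z \<noteq> {} \<and> clopenin tau Q \<and> Q \<noteq> {} \<and> clopenin tau K' \<and> x \<in> K' \<and>
     K' \<subseteq> K \<and> Z \<subseteq> K \<inter> A \<and> Q \<subseteq> X - {y. y \<sqsubset> w} \<and>
     (\<forall>y\<in>Q. \<forall>t\<in>Z. y \<sqsubset> t) \<and> (\<forall>y\<in>K'. \<forall>t\<in>Q. y \<sqsubset> t) \<and>
     ((\<forall>y\<in>Z. \<forall>t\<in>K'. y \<sqsubset> t) \<or> (\<forall>y\<in>Z. \<forall>t\<in>K'. t \<sqsubset> y))"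
proof -
  have X: "x \<in> X" "w \<in> X" "z \<in> X" "q \<in> X" using xw cyc lt_in by blast+
  have zw: "sep z w" and wq: "sep w q" and qz: "sep q z"
    using cycle_separated[OF cyc] cycle_separated[OF cyc(2,3,1)] cycle_separated[OF cyc(3,1,2)] by auto
  have sep_xq: "sep x q"
  proof (rule ccontr)
    assume n: "\<not> sep x q"
    have "\<not> sep q x" using n sep_sym X(1) by blast
    then have "sep w x" using sep_cong[OF wq] X by blast
    then have "q \<sqsubset> w" using gt_class[OF xw _ n X(4)] by blast
    then show False using cyc lt_asym by blast
  qed
  have sep_xz: "sep x z"
  proof (rule ccontr)
    assume n: "\<not> sep x z"
    have "z \<sqsubset> q" using gt_class[OF xq sep_sym[OF sep_xq X(4)] n X(3)] .
    then show False using cyc lt_asym by blast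
  qed
  obtain Q1 Z1 where 1: "clopenin tau Q1" "q \<in> Q1" "clopenin tau Z1" "z \<in> Z1" "\<forall>y\<in>Q1. \<forall>t\<in>Z1. y \<sqsubset> t"
    using separated_clopen_clopen[OF cyc(3) qz] by (elim exE conjE)
  obtain K2 Q2 where 2: "clopenin tau K2" "x \<in> K2" "clopenin tau Q2" "q \<in> Q2" "\<forall>y\<in>K2. \<forall>t\<in>Q2. y \<sqsubset> t"
    using separated_clopen_clopen[OF xq sep_xq] by (elim exE conjE)
  have "x \<noteq> z" using sep_xz unfolding clopen_separated_def by blast
  then consider "x \<sqsubset> z" | "z \<sqsubset> x" using lt_total X by blast
  then obtain K3 Z3 where 3: "clopenin tau K3" "x \<in> K3" "clopenin tau Z3" "z \<in> Z3"
     "(\<forall>y\<in>Z3. \<forall>t\<in>K3. y \<sqsubset> t) \<or> (\<forall>y\<in>Z3. \<forall>t\<in>K3. t \<sqsubset> y)"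
  proof cases
    case 1
    show ?thesis using separated_clopen_clopen[OF 1 sep_xz] that by blast
  next
    case 2
    show ?thesis using separated_clopen_clopen[OF 2 sep_sym[OF sep_xz X(3)]] that by blast
  qed
  obtain Z4 where 4: "clopenin tau Z4" "z \<in> Z4" "Z4 \<subseteq> A" using A[OF z(2) cyc(1) zw] by blast
  obtain L where L: "clopenin tau L" "q \<in> L" "w \<notin> L"
    using sep_sym[OF wq X(4)] unfolding clopen_separated_def by blast
  define Q5 where "Q5 = L \<inter> {y. w \<sqsubset> y}"
  have 5: "clopenin tau Q5" "q \<in> Q5" "Q5 \<subseteq> X - {y. y \<sqsubset> w}"
    unfolding Q5_def using clopenin_above[OF L(1) X(2) L(3)] L(2) cyc(2) lt_in lt_asym by blast+
  define Z where "Z = K \<inter> (Z1 \<inter> (Z3 \<inter> Z4))"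
  define Q where "Q = Q1 \<inter> (Q2 \<inter> Q5)"
  define K' where "K' = K \<inter> (K2 \<inter> K3)"
  have "clopenin tau Z" "clopenin tau Q" "clopenin tau K'"
    unfolding Z_def Q_def K'_def using K 1 2 3 4 5 by (simp_all add: clopenin_Int)
  moreover have "z \<in> Z" "q \<in> Q" "x \<in> K'"
    unfolding Z_def Q_def K'_def using K z 1 2 3 4 5 by auto
  moreover have "K' \<subseteq> K" "Z \<subseteq> K \<inter> A" "Q \<subseteq> X - {y. y \<sqsubset> w}"
    unfolding Z_def Q_def K'_def using 4(3) 5(3) by auto
  moreover have "\<forall>y\<in>Q. \<forall>t\<in>Z. y \<sqsubset> t" "\<forall>y\<in>K'. \<forall>t\<in>Q. y \<sqsubset> t"
    unfolding Z_def Q_def K'_def using 1(5) 2(5) by auto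
  moreover have "(\<forall>y\<in>Z. \<forall>t\<in>K'. y \<sqsubset> t) \<or> (\<forall>y\<in>Z. \<forall>t\<in>K'. t \<sqsubset> y)"
    unfolding Z_def K'_def using 3(5) by auto
  ultimately show ?thesis
    by (intro exI[of _ Z] exI[of _ Q] exI[of _ K'] conjI) auto
qed

lemma cycles_do_not_accumulate:
  assumes "x \<sqsubset> w"
  shows "\<exists>U. openin tau U \<and> x \<in> U \<and> (\<forall>z\<in>U. \<forall>q. z \<sqsubset> w \<longrightarrow> w \<sqsubset> q \<longrightarrow> q \<sqsubset> z \<longrightarrow> \<not> x \<sqsubset> q)"
proof (rule ccontr)
  assume "\<not> ?thesis"
  then have bad: "\<exists>z\<in>U. \<exists>q. z \<sqsubset> w \<and> w \<sqsubset> q \<and> q \<sqsubset> z \<and> x \<sqsubset> q" if "openin tau U" "x \<in> U" for U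
    using that by blast
  obtain K0 A where K0: "clopenin tau K0" "x \<in> K0" and A: "closedin tau A" "A \<subseteq> {y. y \<sqsubset> w}"
      "\<And>z. z \<in> K0 \<Longrightarrow> z \<sqsubset> w \<Longrightarrow> sep z w \<Longrightarrow> \<exists>Z. clopenin tau Z \<and> z \<in> Z \<and> Z \<subseteq> A"
    using clopen_nbhds_away[OF assms] by blast
  define step where "step Z Q K K' \<longleftrightarrow> clopenin tau Z \<and> Z \<noteq> {} \<and> clopenin tau Q \<and> Q \<noteq> {} \<and>
     K' \<subseteq> K \<and> Z \<subseteq> K \<inter> A \<and> Q \<subseteq> X - {y. y \<sqsubset> w} \<and>
     (\<forall>y\<in>Q. \<forall>t\<in>Z. y \<sqsubset> t) \<and> (\<forall>y\<in>K'. \<forall>t\<in>Q. y \<sqsubset> t) \<and>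
     ((\<forall>y\<in>Z. \<forall>t\<in>K'. y \<sqsubset> t) \<or> (\<forall>y\<in>Z. \<forall>t\<in>K'. t \<sqsubset> y))" for Z Q K K'
  have "\<exists>f. \<forall>n. (clopenin tau (f n) \<and> x \<in> f n) \<and> (\<exists>Z Q. step Z Q (f n) (f (Suc n)))"
  proof (rule dependent_nat_choice)
    show "\<exists>K. clopenin tau K \<and> x \<in> K" using K0 by blast
  next
    fix K :: "'a set" and n :: nat
    assume K: "clopenin tau K \<and> x \<in> K"
    have "openin tau (K \<inter> K0)" "x \<in> K \<inter> K0" using K K0 by (auto simp: clopenin_def openin_Int)
    then obtain z q where z: "z \<in> K" "z \<in> K0" "z \<sqsubset> w" "w \<sqsubset> q" "q \<sqsubset> z" "x \<sqsubset> q"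
      using bad[of "K \<inter> K0"] by blast
    then show "\<exists>K'. (clopenin tau K' \<and> x \<in> K') \<and> (\<exists>Z Q. step Z Q K K')"
      using cycle_step[OF A(3) assms _ _ z] K unfolding step_def by blast
  qed
  then obtain f where f: "\<And>n. clopenin tau (f n)" "\<And>n. \<exists>Z Q. step Z Q (f n) (f (Suc n))" by blast
  then obtain Z Q where ZQ: "\<And>n. step (Z n) (Q n) (f n) (f (Suc n))" by metis
  show False
  proof (rule no_nested_cycle_sequence[of Z Q f A "X - {y. y \<sqsubset> w}"])
    show "closedin tau (X - {y. y \<sqsubset> w})" by (rule closedin_not_below)
    show "A \<inter> (X - {y. y \<sqsubset> w}) = {}" using A(2) by blast
  qed (use ZQ f(1) A(1) in \<open>simp_all add: step_def\<close>)
qed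

end

section \<open>The sorted order has open rays\<close>

locale sorted_tournament_space =
  feebly_compact_tournament_space X lt tau + pivot_order X lt W
  for X :: "'a set" and lt :: "'a \<Rightarrow> 'a \<Rightarrow> bool" (infix "\<sqsubset>" 50) and tau W
begin

text \<open>
  Let \<open>p\<close> be the pivot with \<open>x\<close> weakly below \<open>p\<close> and \<open>p\<close> weakly below \<open>y\<close>. For a point \<open>z\<close> near \<open>x\<close>
  that comes after \<open>y\<close>, let \<open>r\<close> be the pivot between \<open>y\<close> and \<open>z\<close>. The bound \<open>w\<close> is \<open>p\<close>, except in the
  case \<open>x = p\<close>, where it is \<open>y\<close>. In all cases both \<open>x\<close> and \<open>w\<close> turn out to be below \<open>r\<close>, so that
  \<open>z \<sqsubset> w \<sqsubset> r \<sqsubset> z\<close> is one of the cycles that cannot come close to \<open>x\<close>.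
\<close>
lemma openin_before: "openin tau {x. before x y}"
proof (subst openin_subopen, intro ballI)
  fix x assume "x \<in> {x. before x y}"
  then have "before x y" by simp
  then obtain p where xy: "x \<noteq> y" and p: "p \<in> X" "x \<in> cell p" "y \<in> cell p" "x = p \<or> x \<sqsubset> p" "y = p \<or> p \<sqsubset> y"
    by (rule beforeE)
  have X: "x \<in> X" "y \<in> X" using p cell_in by auto
  define w where "w = (if x = p then y else p)"
  have xw: "x \<sqsubset> w" using xy p unfolding w_def by auto
  obtain U where U: "openin tau U" "x \<in> U"
     "\<And>z q. z \<in> U \<Longrightarrow> z \<sqsubset> w \<Longrightarrow> w \<sqsubset> q \<Longrightarrow> q \<sqsubset> z \<Longrightarrow> \<not> x \<sqsubset> q"
    using cycles_do_not_accumulate[OF xw] by blast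
  have "before z y" if z: "z \<in> U" "z \<sqsubset> w" for z
  proof (rule ccontr)
    assume nb: "\<not> before z y"
    have zX: "z \<in> X" using z lt_in by blast
    have "z \<noteq> y"
      using z(2) p(5) unfolding w_def by (auto split: if_splits dest: lt_asym)
    then have "before y z" using before_total[OF zX X(2)] nb by blast
    then obtain r where r: "r \<in> X" "y \<in> cell r" "z \<in> cell r" "y = r \<or> y \<sqsubset> r" "z = r \<or> r \<sqsubset> z"
      by (rule beforeE)
    have "x \<sqsubset> r \<and> w \<sqsubset> r"
    proof -
      consider "r = p" | "(r, p) \<in> W" | "(p, r) \<in> W" using totalW by blast
      then show ?thesis
      proof cases
        case 1
        have "y = p" using 1 r(4) p(5) by (auto dest: lt_asym)
        then show ?thesis using 1 r(5) z(2) xy unfolding w_def by (auto split: if_splits dest: lt_asym)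
      next
        case 2
        have s: "same_side r p y" "same_side r x y"
          using later_cell_same_side[OF 2 r(1) p(1) r(2) p(3) p(2)] by blast+
        have "y \<noteq> r"
          using s xy lt_total[OF X(1) r(1)] unfolding same_side_def by auto
        then have "y \<sqsubset> r" using r(4) by blast
        then show ?thesis using s unfolding same_side_def w_def by auto
      next
        case 3
        have s: "same_side p r y" "same_side p z y"
          using later_cell_same_side[OF 3 p(1) r(1) p(3) r(2) r(3)] by blast+
        show ?thesis
        proof (cases "x = p")
          case True
          then have "p \<sqsubset> y" using p(5) xy by blast
          then have "p \<sqsubset> r" using s unfolding same_side_def by blast
          moreover have "y \<noteq> r" using z(2) r(5) True unfolding w_def by (auto dest: lt_asym)
          ultimately show ?thesis using True r(4) unfolding w_def by auto
        next
          case False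
          then have "z \<sqsubset> p" using z(2) unfolding w_def by simp
          then have "y \<sqsubset> p" using s unfolding same_side_def by blast
          then show ?thesis using p(5) by (auto dest: lt_asym)
        qed
      qed
    qed
    moreover have "z \<noteq> r" using calculation z(2) by (auto dest: lt_asym)
    ultimately show False using U(3)[OF z] r(5) by blast
  qed
  then have "U \<inter> {z. z \<sqsubset> w} \<subseteq> {x. before x y}" by blast
  moreover have "openin tau (U \<inter> {z. z \<sqsubset> w})" using U(1) openin_below openin_Int by blast
  ultimately show "\<exists>V. openin tau V \<and> x \<in> V \<and> V \<subseteq> {x. before x y}" using U(2) xw by blast
qed

lemma sorted_tournament_space_reverse: "sorted_tournament_space X (\<lambda>x y. y \<sqsubset> x) tau W"
  using feebly_compact_reverse pivot_order_reverse by (simp add: sorted_tournament_space_def)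

lemma openin_after: "openin tau {x. before y x}"
  using sorted_tournament_space.openin_before[OF sorted_tournament_space_reverse, of y]
  by (simp add: before_reverse)

end

section \<open>Quasi-kings and lexicographic selections\<close>

context tournament
begin

definition winner :: "'a set \<Rightarrow> 'a" where
  "winner S = (SOME a. a \<in> S \<and> (\<forall>b\<in>S. b = a \<or> a \<sqsubset> b))"

lemma winner_pair:
  assumes "x = y \<or> x \<sqsubset> y"
  shows "winner {x, y} = x"
  unfolding winner_def by (rule some_equality) (use assms in \<open>auto dest: lt_asym\<close>)

lemma winner_pair_in:
  assumes "x \<in> X" "y \<in> X"
  shows "winner {x, y} \<in> {x, y}"
  using winner_pair[of x y] winner_pair[of y x] lt_total[OF assms] by (auto simp: insert_commute)

lemma sel_less_winner:
  assumes "x \<in> X" "y \<in> X"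
  shows "sel_less winner x y \<longleftrightarrow> x \<sqsubset> y"
  using winner_pair[of x y] winner_pair[of y x] lt_total[OF assms]
  unfolding sel_less_def sel_le_def by (auto simp: insert_commute)

end

lemma F2_cases:
  assumes "S \<in> F2 X"
  obtains x y where "x \<in> X" "y \<in> X" "S = {x, y}"
proof -
  have "card S = 1 \<or> card S = 2" "S \<subseteq> X" using assms unfolding F2_def by auto
  then show ?thesis using that
    by (metis card_1_singletonE card_2_iff insert_absorb2 insert_subset)
qed

lemma pair_in_F2: "x \<in> X \<Longrightarrow> y \<in> X \<Longrightarrow> {x, y} \<in> F2 X"
  unfolding F2_def by (cases "x = y") auto

lemma (in tournament) weak_selection_winner: "weak_selection_on X winner"
  unfolding weak_selection_on_def using winner_pair_in by (metis F2_cases)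

lemma tournament_of_selection:
  assumes "weak_selection_on X \<sigma>"
  shows "tournament X (\<lambda>x y. x \<in> X \<and> y \<in> X \<and> sel_less \<sigma> x y)"
proof
  show "(x \<in> X \<and> y \<in> X \<and> sel_less \<sigma> x y) \<or> (y \<in> X \<and> x \<in> X \<and> sel_less \<sigma> y x)"
    if "x \<in> X" "y \<in> X" "x \<noteq> y" for x y
    using assms pair_in_F2[OF that(1,2)] that
    unfolding weak_selection_on_def sel_less_def sel_le_def by (metis empty_iff insert_commute insert_iff)
qed (auto simp: sel_less_def sel_le_def insert_commute)

lemma tournament_lexicographic:
  fixes f :: "'a \<Rightarrow> nat"
  assumes "tournament X lt"
  shows "tournament X (\<lambda>x y. x \<in> X \<and> y \<in> X \<and> (f x < f y \<or> f x = f y \<and> lt x y))"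
proof -
  interpret tournament X lt by fact
  show ?thesis by unfold_locales (use lt_total in \<open>auto simp: not_less_iff_gr_or_eq dest: lt_asym\<close>)
qed

lemma coarser_topology_generated_by_iff:
  "coarser_topology (topology_generated_by B) T \<longleftrightarrow> (\<forall>U\<in>B. openin T U)"
proof
  show "coarser_topology (topology_generated_by B) T \<Longrightarrow> \<forall>U\<in>B. openin T U"
    unfolding coarser_topology_def using topology_generated_by_Basis by blast
  show "coarser_topology (topology_generated_by B) T" if "\<forall>U\<in>B. openin T U"
    unfolding coarser_topology_def openin_topology_generated_by_iff
    using generate_topology_on_coarsest[OF istopology_openin, of B T] that by blast
qed

lemma separately_continuous_iff:
  "separately_continuous_weak_selection T \<sigma> \<longleftrightarrow> weak_selection_on (topspace T) \<sigma> \<and>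
     (\<forall>x\<in>topspace T. openin T {y \<in> topspace T. sel_less \<sigma> y x} \<and> openin T {y \<in> topspace T. sel_less \<sigma> x y})"
  unfolding separately_continuous_weak_selection_def selection_topology_def coarser_topology_generated_by_iff
  by auto

lemma successively_imp_le:
  fixes f :: "'a \<Rightarrow> nat"
  assumes "successively P (x # zs)" "set (x # zs) \<subseteq> X"
    and "\<And>a b. a \<in> X \<Longrightarrow> b \<in> X \<Longrightarrow> P a b \<Longrightarrow> f a \<le> f b"
  shows "z \<in> set zs \<Longrightarrow> f x \<le> f z"
  using assms(1,2)
proof (induction zs arbitrary: x)
  case (Cons y zs)
  have "f x \<le> f y" using Cons.prems assms(3)[of x y] by simp
  moreover have "z = y \<or> f y \<le> f z" using Cons.IH[of y] Cons.prems by auto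
  ultimately show ?case by auto
qed simp

text \<open>
  Along the relation of the lexicographic selection \<open>f\<close> is nondecreasing, so a quasi-king maximises
  \<open>f\<close>.
\<close>
lemma quasi_king_bounds_locally_constant:
  fixes f :: "'a \<Rightarrow> nat"
  assumes king: "quasi_king_space T" and sel: "separately_continuous_weak_selection T \<sigma>"
    and f: "\<And>k. openin T {x \<in> topspace T. f x = k}"
  shows "\<exists>m. \<forall>x\<in>topspace T. f x \<le> m"
proof -
  define X where "X = topspace T"
  have ws: "weak_selection_on X \<sigma>" and rays: "\<And>x. x \<in> X \<Longrightarrow> openin T {y \<in> X. sel_less \<sigma> y x}"
      "\<And>x. x \<in> X \<Longrightarrow> openin T {y \<in> X. sel_less \<sigma> x y}"
    using sel unfolding separately_continuous_iff X_def by auto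
  define lex where "lex = (\<lambda>x y. x \<in> X \<and> y \<in> X \<and> (f x < f y \<or> f x = f y \<and> (x \<in> X \<and> y \<in> X \<and> sel_less \<sigma> x y)))"
  interpret lex: tournament X lex
    unfolding lex_def by (rule tournament_lexicographic[OF tournament_of_selection[OF ws]])
  have level: "openin T {x \<in> X. P (f x)}" for P
  proof -
    have "{x \<in> X. P (f x)} = (\<Union>k\<in>Collect P. {x \<in> X. f x = k})" by auto
    then show ?thesis using f unfolding X_def by auto
  qed
  have "separately_continuous_weak_selection T lex.winner"
    unfolding separately_continuous_iff X_def[symmetric]
  proof (intro conjI ballI lex.weak_selection_winner)
    fix x assume x: "x \<in> X"
    have "{y \<in> X. sel_less lex.winner y x} =
        {y \<in> X. f y < f x} \<union> ({y \<in> X. f y = f x} \<inter> {y \<in> X. sel_less \<sigma> y x})"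
      using x lex.sel_less_winner[OF _ x] unfolding lex_def by auto
    moreover have "openin T ({y \<in> X. f y < f x} \<union> ({y \<in> X. f y = f x} \<inter> {y \<in> X. sel_less \<sigma> y x}))"
      using level[of "\<lambda>k. k < f x"] level[of "\<lambda>k. k = f x"] rays(1)[OF x] by (intro openin_Un openin_Int)
    ultimately show "openin T {y \<in> X. sel_less lex.winner y x}" by simp
    have "{y \<in> X. sel_less lex.winner x y} =
        {y \<in> X. f x < f y} \<union> ({y \<in> X. f y = f x} \<inter> {y \<in> X. sel_less \<sigma> x y})"
      using x lex.sel_less_winner[OF x] unfolding lex_def by auto
    moreover have "openin T ({y \<in> X. f x < f y} \<union> ({y \<in> X. f y = f x} \<inter> {y \<in> X. sel_less \<sigma> x y}))"
      using level[of "\<lambda>k. f x < k"] level[of "\<lambda>k. k = f x"] rays(2)[OF x] by (intro openin_Un openin_Int)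
    ultimately show "openin T {y \<in> X. sel_less lex.winner x y}" by simp
  qed
  then obtain q where "quasi_sel_king X lex.winner q"
    using king unfolding quasi_king_space_def X_def by blast
  then have q: "q \<in> X" "\<And>x. x \<in> X \<Longrightarrow> \<exists>ys. set ys \<subseteq> X \<and> successively (sel_le lex.winner) (x # ys @ [q])"
    unfolding quasi_sel_king_def by blast+
  have "f x \<le> f q" if x: "x \<in> X" for x
  proof -
    obtain ys where ys: "set ys \<subseteq> X" "successively (sel_le lex.winner) (x # ys @ [q])"
      using q(2)[OF x] by blast
    have mono: "f a \<le> f b" if "a \<in> X" "b \<in> X" "sel_le lex.winner a b" for a b
      using that lex.sel_less_winner[OF that(1,2)] unfolding sel_less_def lex_def by force
    show ?thesis
      by (rule successively_imp_le[OF ys(2) _ mono]) (use ys(1) q(1) x in auto)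
  qed
  then show ?thesis unfolding X_def by blast
qed

text \<open>
  Without a cluster point the family is locally finite. Then \<open>f x\<close>, the largest index of a member
  that contains \<open>x\<close> (or 0 if there is none), is locally constant and unbounded.
\<close>
lemma cluster_point_of_clopen_sets:
  fixes G :: "nat \<Rightarrow> 'a set"
  assumes bounded: "\<And>f :: 'a \<Rightarrow> nat. (\<And>k. openin T {x \<in> topspace T. f x = k}) \<Longrightarrow> \<exists>m. \<forall>x\<in>topspace T. f x \<le> m"
    and N: "infinite N" and G: "\<forall>n\<in>N. clopenin T (G n) \<and> G n \<noteq> {}"
  shows "\<exists>p\<in>topspace T. \<forall>U. openin T U \<longrightarrow> p \<in> U \<longrightarrow> infinite {n \<in> N. G n \<inter> U \<noteq> {}}"
proof (rule ccontr)
  assume "\<not> ?thesis"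
  then have lf: "\<exists>U. openin T U \<and> p \<in> U \<and> finite {n \<in> N. G n \<inter> U \<noteq> {}}" if "p \<in> topspace T" for p
    using that by blast
  have fin: "finite {n \<in> N. p \<in> G n}" if p: "p \<in> topspace T" for p
  proof -
    obtain U where U: "p \<in> U" "finite {n \<in> N. G n \<inter> U \<noteq> {}}" using lf[OF p] by blast
    show ?thesis by (rule finite_subset[OF _ U(2)]) (use U(1) in blast)
  qed
  define f where "f x = Max (insert 0 {n \<in> N. x \<in> G n})" for x
  have "openin T {x \<in> topspace T. f x = k}" for k
  proof (subst openin_subopen, intro ballI)
    fix p assume "p \<in> {x \<in> topspace T. f x = k}"
    then have p: "p \<in> topspace T" "f p = k" by auto
    obtain U where U: "openin T U" "p \<in> U" "finite {n \<in> N. G n \<inter> U \<noteq> {}}" using lf[OF p(1)] by blast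
    define H where "H n = (if p \<in> G n then G n else topspace T - G n)" for n
    define V where "V = (\<Inter>n\<in>{n \<in> N. G n \<inter> U \<noteq> {}}. H n) \<inter> topspace T"
    have "openin T V"
      unfolding V_def
    proof (rule openin_INT[OF U(3)])
      fix n assume "n \<in> {n \<in> N. G n \<inter> U \<noteq> {}}"
      then show "openin T (H n)" using G unfolding H_def clopenin_def by auto
    qed
    moreover have "p \<in> V" using p(1) unfolding V_def H_def by auto
    moreover have "f v = k" if v: "v \<in> U \<inter> V" for v
    proof -
      have "v \<in> G n \<longleftrightarrow> p \<in> G n" if n: "n \<in> N" for n
      proof (cases "G n \<inter> U = {}")
        case True
        then show ?thesis using v U(2) by blast
      next
        case False
        then have "v \<in> H n" using v n unfolding V_def by blast
        then show ?thesis unfolding H_def by (auto split: if_splits)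
      qed
      then have "{n \<in> N. v \<in> G n} = {n \<in> N. p \<in> G n}" by blast
      then show ?thesis using p(2) unfolding f_def by simp
    qed
    ultimately show "\<exists>S. openin T S \<and> p \<in> S \<and> S \<subseteq> {x \<in> topspace T. f x = k}"
      using U(1,2) by (intro exI[of _ "U \<inter> V"]) (auto simp: openin_Int V_def)
  qed
  then obtain m where m: "\<And>x. x \<in> topspace T \<Longrightarrow> f x \<le> m" using bounded by blast
  obtain n where n: "n > m" "n \<in> N" using N unfolding infinite_nat_iff_unbounded by blast
  obtain x where x: "x \<in> G n" using G n(2) by blast
  have xT: "x \<in> topspace T" using x G n(2) clopenin_subset by blast
  have "n \<le> f x" unfolding f_def by (rule Max_ge) (use fin[OF xT] n x in auto)
  then show False using m[OF xT] n by simp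
qed

theorem corollary6p5:
  fixes T :: "'a topology"
  assumes "Hausdorff_space T"
    and "quasi_king_space T"
    and "\<exists>\<sigma>. properly_continuous_weak_selection T \<sigma>"
  shows "weakly_orderable_space T"
proof -
  define X where "X = topspace T"
  obtain \<sigma> where "properly_continuous_weak_selection T \<sigma>" using assms(3) by blast
  define tau where "tau = selection_topology X \<sigma>"
  define lt where "lt = (\<lambda>x y. x \<in> X \<and> y \<in> X \<and> sel_less \<sigma> x y)"
  have ws: "weak_selection_on X \<sigma>" and coarse: "coarser_topology tau T"
    and cont: "continuous_weak_selection tau \<sigma>"
    using \<open>properly_continuous_weak_selection T \<sigma>\<close>
    unfolding properly_continuous_weak_selection_def tau_def X_def by auto
  have sel: "separately_continuous_weak_selection T \<sigma>"
    using ws coarse unfolding separately_continuous_weak_selection_def tau_def X_def by blast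
  obtain W0 :: "'a rel" where W0: "well_order_on UNIV W0" using well_order_on by blast
  define W where "W = W0 - Id"
  interpret tournament X lt unfolding lt_def by (rule tournament_of_selection[OF ws])
  have W0': "trans W0" "antisym W0" "total W0"
    using W0 unfolding well_order_on_def linear_order_on_def partial_order_on_def preorder_on_def by auto
  interpret pivot_order X lt W
  proof
    show "wf W" using W0 unfolding W_def well_order_on_def by blast
    show "trans W" unfolding W_def using trans_diff_Id[OF W0'(1,2)] .
    show "(x, y) \<in> W \<or> (y, x) \<in> W" if "x \<noteq> y" for x y
      using W0'(3) that unfolding W_def total_on_def by auto
  qed
  have tau_eq: "tau = topology_generated_by ({X} \<union> {{y. lt y x} |x. x \<in> X} \<union> {{y. lt x y} |x. x \<in> X})"
  proof -
    have "{y \<in> X. sel_less \<sigma> y x} = {y. lt y x}" "{y \<in> X. sel_less \<sigma> x y} = {y. lt x y}"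
      if "x \<in> X" for x
      using that unfolding lt_def by auto
    then have "{{y \<in> X. sel_less \<sigma> y x} |x. x \<in> X} = {{y. lt y x} |x. x \<in> X}"
      "{{y \<in> X. sel_less \<sigma> x y} |x. x \<in> X} = {{y. lt x y} |x. x \<in> X}"
      unfolding Setcompr_eq_image by (auto intro!: image_cong)
    then show ?thesis unfolding tau_def selection_topology_def by simp
  qed
  have top: "topspace tau = X"
    unfolding tau_eq topology_generated_by_topspace using lt_in by auto
  interpret tournament_space X lt tau
  proof
    show "\<exists>U V. openin tau U \<and> openin tau V \<and> x \<in> U \<and> y \<in> V \<and> (\<forall>s\<in>U. \<forall>t\<in>V. lt s t)" if "lt x y" for x y
    proof -
      have "x \<in> X" "y \<in> X" "sel_less \<sigma> x y" using that unfolding lt_def by auto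
      then obtain U V where UV: "openin tau U" "openin tau V" "x \<in> U" "y \<in> V" "\<forall>s\<in>U. \<forall>t\<in>V. sel_less \<sigma> s t"
        using cont unfolding continuous_weak_selection_def top by blast
      moreover have "U \<subseteq> X" "V \<subseteq> X" using UV(1,2) openin_subset top by auto
      ultimately show ?thesis unfolding lt_def by blast
    qed
  qed (rule tau_eq)
  have bounded: "\<exists>m. \<forall>x\<in>topspace tau. f x \<le> m"
    if "\<And>k. openin tau {x \<in> topspace tau. f x = k}" for f :: "'a \<Rightarrow> nat"
    using quasi_king_bounds_locally_constant[OF assms(2) sel, of f] that coarse
    unfolding coarser_topology_def top X_def by blast
  interpret sorted_tournament_space X lt tau W
  proof
    show "\<exists>p\<in>X. \<forall>U. openin tau U \<longrightarrow> p \<in> U \<longrightarrow> infinite {n \<in> N. G n \<inter> U \<noteq> {}}"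
      if "infinite N" "\<forall>n\<in>N. clopenin tau (G n) \<and> G n \<noteq> {}" for N :: "nat set" and G
      using cluster_point_of_clopen_sets[OF bounded that] unfolding top .
  qed
  define r where "r = {(x, y). x \<in> X \<and> y \<in> X \<and> (x = y \<or> before x y)}"
  have "linear_order_on X r"
    unfolding linear_order_on_def partial_order_on_def preorder_on_def
  proof (intro conjI)
    show "refl_on X r" unfolding r_def refl_on_def by auto
    show "trans r" unfolding r_def trans_def using before_trans by blast
    show "antisym r" unfolding r_def antisym_def using before_asym by blast
    show "total_on X r" unfolding r_def total_on_def using before_total by blast
  qed (auto simp: r_def)
  moreover have "coarser_topology (open_interval_topology X r) T"
    unfolding open_interval_topology_def coarser_topology_generated_by_iff
  proof
    have rays: "{y \<in> X. (y, x) \<in> r \<and> y \<noteq> x} = {y. before y x}" "{y \<in> X. (x, y) \<in> r \<and> x \<noteq> y} = {y. before x y}"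
      if "x \<in> X" for x
      using that before_in before_asym unfolding r_def by blast+
    fix U assume "U \<in> {X} \<union> {{y \<in> X. (y, x) \<in> r \<and> y \<noteq> x} |x. x \<in> X} \<union> {{y \<in> X. (x, y) \<in> r \<and> x \<noteq> y} |x. x \<in> X}"
    then have "openin tau U"
      using rays openin_before openin_after clopenin_X unfolding clopenin_def by auto
    then show "openin T U" using coarse unfolding coarser_topology_def by blast
  qed
  ultimately show ?thesis unfolding weakly_orderable_space_def X_def by blast
qed

end
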